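(* Consider the contextual bilateral trade problem in the one-bit feedback model. There exists an efficiency-maximizing algorithm that achieves regret $O(d \log d)$ and whose negative profit $\sum_{t=1}^T \max\{0,-\mathrm{Profit}_t(p_t,q_t)\}$ is at most $O(d \log d)$.
   Context: Contextual bilateral trade: Let $\mathbb{B}=\{w\in\mathbb{R}^d:\|w\|_2\le 1\}$. There are two fixed vectors $s,b\in\mathbb{B}$ unknown to the learner. At each time $t=1,\dots,T$, the learner observes a context $x_t\in\mathbb{B}$ (the contexts and $s,b$ are fixed in advance by an oblivious adversary; this is an instance), and posts a price $p_t$ to the seller and $q_t$ to the buyer (possibly $p_t>q_t$). Valuations: $s_t=\langle s,x_t\rangle$, $b_t=\langle b,x_t\rangle$; the trade happens iff $s_t\le p_t$ and $q_t\le b_t$. Gain from trade: $\mathrm{GFT}_t(p_t,q_t)=(b_t-s_t)\,\mathbb{1}\{s_t\le p_t\}\mathbb{1}\{q_t\le b_t\}$; profit: $\mathrm{Profit}_t(p_t,q_t)=(q_t-p_t)\,\mathbb{1}\{s_t\le p_t\}\mathbb{1}\{q_t\le b_t\}$. One-bit feedback: after each round the learner observes only $\mathbb{1}\{s_t\le p_t\}\cdot\mathbb{1}\{q_t\le b_t\}$. Regret of a (possibly randomized) algorithm $\mathcal{A}$: $R_T(\mathcal{A})=\sup_{\mathcal{I}}\mathbb{E}\big[\sum_{t=1}^T (b_t-s_t)_+-\sum_{t=1}^T\mathrm{GFT}_t(p_t,q_t)\big]$. The $O(\cdot)$ hides absolute constants independent of $d$ and $T$. *)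

theory Defs
  imports Complex_Main
begin

(* Vectors of R^d are represented as functions nat => real; only the
   coordinates i < d are meaningful. *)
definition inner_d :: "nat \<Rightarrow> (nat \<Rightarrow> real) \<Rightarrow> (nat \<Rightarrow> real) \<Rightarrow> real" where
  "inner_d d u v = (\<Sum>i<d. u i * v i)"

definition in_ball :: "nat \<Rightarrow> (nat \<Rightarrow> real) \<Rightarrow> bool" where
  "in_ball d v \<longleftrightarrow> (\<forall>i\<ge>d. v i = 0) \<and> (\<Sum>i<d. (v i)\<^sup>2) \<le> 1"

(* A (deterministic) learner: given the dimension d, the history of past
   (context, one-bit feedback) pairs and the current context, it posts
   (p, q) = (price to seller, price to buyer). *)
type_synonym policy =
  "nat \<Rightarrow> ((nat \<Rightarrow> real) \<times> bool) list \<Rightarrow> (nat \<Rightarrow> real) \<Rightarrow> real \<times> real"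

definition trade :: "real \<Rightarrow> real \<Rightarrow> real \<times> real \<Rightarrow> bool" where
  "trade st bt pq \<longleftrightarrow> st \<le> fst pq \<and> snd pq \<le> bt"

definition gft :: "real \<Rightarrow> real \<Rightarrow> real \<times> real \<Rightarrow> real" where
  "gft st bt pq = (if trade st bt pq then bt - st else 0)"

definition profit :: "real \<Rightarrow> real \<Rightarrow> real \<times> real \<Rightarrow> real" where
  "profit st bt pq = (if trade st bt pq then snd pq - fst pq else 0)"

fun hist :: "policy \<Rightarrow> nat \<Rightarrow> (nat \<Rightarrow> real) \<Rightarrow> (nat \<Rightarrow> real) \<Rightarrow>
              (nat \<Rightarrow> nat \<Rightarrow> real) \<Rightarrow> nat \<Rightarrow> ((nat \<Rightarrow> real) \<times> bool) list" where
  "hist A d s b x 0 = []"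
| "hist A d s b x (Suc t) =
     hist A d s b x t @
       [(x t, trade (inner_d d s (x t)) (inner_d d b (x t)) (A d (hist A d s b x t) (x t)))]"

definition prices :: "policy \<Rightarrow> nat \<Rightarrow> (nat \<Rightarrow> real) \<Rightarrow> (nat \<Rightarrow> real) \<Rightarrow>
              (nat \<Rightarrow> nat \<Rightarrow> real) \<Rightarrow> nat \<Rightarrow> real \<times> real" where
  "prices A d s b x t = A d (hist A d s b x t) (x t)"

definition regret :: "policy \<Rightarrow> nat \<Rightarrow> (nat \<Rightarrow> real) \<Rightarrow> (nat \<Rightarrow> real) \<Rightarrow>
              (nat \<Rightarrow> nat \<Rightarrow> real) \<Rightarrow> nat \<Rightarrow> real" where
  "regret A d s b x T =
     (\<Sum>t<T. max 0 (inner_d d b (x t) - inner_d d s (x t)))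
     - (\<Sum>t<T. gft (inner_d d s (x t)) (inner_d d b (x t)) (prices A d s b x t))"

definition neg_profit :: "policy \<Rightarrow> nat \<Rightarrow> (nat \<Rightarrow> real) \<Rightarrow> (nat \<Rightarrow> real) \<Rightarrow>
              (nat \<Rightarrow> nat \<Rightarrow> real) \<Rightarrow> nat \<Rightarrow> real" where
  "neg_profit A d s b x T =
     (\<Sum>t<T. max 0 (- profit (inner_d d s (x t)) (inner_d d b (x t)) (prices A d s b x t)))"

end

theory Submission
  imports Defs "HOL-Analysis.Analysis"
begin

text \<open>
  The learner keeps the sets \<open>S\<close> and \<open>B\<close> of seller and buyer vectors consistent with the feedback.
  A context that leaves the sign of \<open>b\<^sub>t - s\<^sub>t\<close> open costs at most three times the larger width \<open>w\<close>
  of the two intervals of possible valuations, and the feedback bit is spent on the wider one.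

  With \<open>w\<close> of order \<open>2\<^bsup>-i\<^esup>\<close>, the price splits the volume of the \<open>z\<close>-fattening of that set roughly in
  half, where \<open>z\<close> is of order \<open>2\<^bsup>-i\<^esup> / d\<close>. By convexity a slab of thickness \<open>2 z\<close> carries at most a
  quarter of that volume, hence the fattening of the updated set has at most 3/4 of the volume. Since
  the volume of the fattening stays between \<open>(2 z / d)\<^bsup>d\<^esup>\<close> and \<open>4\<^bsup>d\<^esup>\<close>, only \<open>O(d (i + log d))\<close> rounds
  have scale \<open>i\<close>, and the sum of \<open>2\<^bsup>-i\<^esup> d (i + log d)\<close> over all \<open>i\<close> is \<open>O(d log d)\<close>. The potential
  \<open>\<Sum>i<n. 2\<^bsup>-i\<^esup> ln V\<^sub>i\<close>, with \<open>V\<^sub>i\<close> the volume at scale \<open>i\<close>, performs this count.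
\<close>

section \<open>Volume of thin slabs\<close>

abbreviation lebesgue_d :: "nat \<Rightarrow> (nat \<Rightarrow> real) measure" where
  "lebesgue_d d \<equiv> \<Pi>\<^sub>M i\<in>{..<d}. lborel"

text \<open>Restricting to \<open>{..<d}\<close> puts the image into the carrier of
  \<open>lebesgue_d d\<close>, which consists of extensional functions, whatever function the centre
  is.\<close>

definition homothety :: "nat \<Rightarrow> (nat \<Rightarrow> real) \<Rightarrow> real \<Rightarrow> (nat \<Rightarrow> real) \<Rightarrow> nat \<Rightarrow> real" where
  "homothety d c k y = (\<lambda>i\<in>{..<d}. c i + k * (y i - c i))"

lemma homothety_measurable [measurable]:
  "homothety d c k \<in> measurable (lebesgue_d d) (lebesgue_d d)"
  unfolding homothety_def by measurable

lemma homothety_inverse: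
  assumes "k \<noteq> 0" "y \<in> extensional {..<d}"
  shows "homothety d c k (homothety d c (1 / k) y) = y"
  using assms by (auto simp: homothety_def fun_eq_iff extensional_def)

lemma inner_homothety:
  "inner_d d (homothety d c k y) x = inner_d d c x + k * (inner_d d y x - inner_d d c x)"
  by (simp add: inner_d_def homothety_def sum.distrib sum_distrib_left sum_subtractf algebra_simps)

interpretation lborel_prod: product_sigma_finite "\<lambda>_::nat. lborel :: real measure"
  by standard

lemma emeasure_lborel_affine_vimage:
  fixes k t :: real
  assumes "k > 0" "A \<in> sets borel"
  shows "ennreal k * emeasure lborel ((\<lambda>r. t + k * r) -` A) = emeasure lborel A"
proof -
  have "emeasure lborel A = emeasure (density (distr lborel borel (\<lambda>r. t + k * r)) (\<lambda>_. ennreal \<bar>k\<bar>)) A"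
    using lborel_real_affine[of k t] assms by simp
  then show ?thesis
    using assms by (simp add: emeasure_density nn_integral_cmult emeasure_distr)
qed

text \<open>The pushforward under the homothety, rescaled by \<open>k ^ d\<close>, agrees with the
  product measure on boxes, and boxes determine that measure.\<close>

lemma emeasure_homothety_vimage:
  assumes k: "k > 0" and A: "A \<in> sets (lebesgue_d d)"
  shows "ennreal (k ^ d) * emeasure (lebesgue_d d) (homothety d c k -` A \<inter> space (lebesgue_d d))
       = emeasure (lebesgue_d d) A"
proof -
  let ?M = "lebesgue_d d"
  let ?P = "scale_measure (ennreal (k ^ d)) (distr ?M ?M (homothety d c k))"
  have "?P = ?M"
  proof (rule lborel_prod.PiM_eqI)
    fix A :: "nat \<Rightarrow> real set"
    assume A: "\<And>i. i \<in> {..<d} \<Longrightarrow> A i \<in> sets lborel"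
    have eq: "homothety d c k -` Pi\<^sub>E {..<d} A \<inter> space ?M
        = (\<Pi>\<^sub>E i\<in>{..<d}. (\<lambda>r. (c i - k * c i) + k * r) -` A i)"
      by (auto simp: homothety_def space_PiM PiE_iff algebra_simps)
    have meas: "(\<lambda>r. (c i - k * c i) + k * r) -` A i \<in> sets lborel" if "i \<in> {..<d}" for i
      using A[OF that] measurable_sets_borel[of "\<lambda>r. (c i - k * c i) + k * r" borel "A i"] by simp
    have "emeasure ?P (Pi\<^sub>E {..<d} A)
        = ennreal (k ^ d) * (\<Prod>i<d. emeasure lborel ((\<lambda>r. (c i - k * c i) + k * r) -` A i))"
      using A meas lborel_prod.emeasure_PiM[of "{..<d}" "\<lambda>i. (\<lambda>r. (c i - k * c i) + k * r) -` A i"]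
      by (simp add: emeasure_distr eq sets_PiM_I_finite)
    also have "\<dots> = (\<Prod>i<d. ennreal k * emeasure lborel ((\<lambda>r. (c i - k * c i) + k * r) -` A i))"
      using k by (simp add: prod.distrib ennreal_power)
    also have "\<dots> = (\<Prod>i<d. emeasure lborel (A i))"
      using A k by (intro prod.cong refl emeasure_lborel_affine_vimage) auto
    finally show "emeasure ?P (Pi\<^sub>E {..<d} A) = (\<Prod>i\<in>{..<d}. emeasure lborel (A i))" .
  qed simp_all
  then have "emeasure ?M A = emeasure ?P A" by simp
  also have "\<dots> = ennreal (k ^ d) * emeasure ?M (homothety d c k -` A \<inter> space ?M)"
    using A by (simp add: emeasure_distr)
  finally show ?thesis ..
qed

text \<open>The preimage under ratio \<open>1 / k\<close> is the image under ratio \<open>k\<close>;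
  as a preimage it is measurable at once.\<close>

lemma measure_homothety_vimage:
  assumes "k > 0" "A \<in> sets (lebesgue_d d)"
  shows "measure (lebesgue_d d) (homothety d c (1 / k) -` A \<inter> space (lebesgue_d d))
       = k ^ d * measure (lebesgue_d d) A"
proof -
  have "(1 / k) ^ d * measure (lebesgue_d d) (homothety d c (1 / k) -` A \<inter> space (lebesgue_d d))
       = measure (lebesgue_d d) A"
    using emeasure_homothety_vimage[of "1 / k" A d c] assms
    by (simp add: measure_def enn2real_mult flip: enn2real_mult)
       (metis enn2real_ennreal enn2real_mult less_eq_real_def zero_le_divide_1_iff zero_le_power)
  then show ?thesis using assms by (simp add: field_simps power_divide)
qed

text \<open>Five homothetic copies of the slab, with centre \<open>c\<close> and ratios \<open>\<rho> ^ j\<close>, are pairwise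
  disjoint, stay inside \<open>K\<close>, and each keeps at least 4/5 of the volume of the slab.\<close>

lemma slab_volume_le:
  fixes a \<delta> :: real
  assumes K: "K \<in> sets (lebesgue_d d)" "emeasure (lebesgue_d d) K < \<infinity>"
    and star: "\<And>y k. y \<in> K \<Longrightarrow> 0 \<le> k \<Longrightarrow> k \<le> 1 \<Longrightarrow> homothety d c k y \<in> K"
    and a: "0 < a" and \<delta>: "0 < \<delta>" "40 * real d * \<delta> \<le> a"
    and A: "A \<in> sets (lebesgue_d d)" "A \<subseteq> K"
      "\<And>y. y \<in> A \<Longrightarrow> a \<le> inner_d d y x - inner_d d c x \<and> inner_d d y x - inner_d d c x \<le> a + \<delta>"
  shows "4 * measure (lebesgue_d d) A \<le> measure (lebesgue_d d) K"
proof -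
  let ?M = "lebesgue_d d"
  \<comment> \<open>Taking \<open>2 * \<delta>\<close> instead of \<open>\<delta>\<close> makes
    \<open>\<rho> * (a + \<delta>) < a\<close> strict, so consecutive copies do not touch.\<close>
  define \<rho> where "\<rho> = a / (a + 2 * \<delta>)"
  have \<rho>: "0 < \<rho>" "\<rho> < 1" "\<rho> * (a + \<delta>) < a"
    using a \<delta> by (auto simp: \<rho>_def field_simps)
  define C where "C j = homothety d c (1 / \<rho> ^ j) -` A \<inter> space ?M" for j
  have C_meas: "C j \<in> sets ?M" for j
    unfolding C_def using A(1) by measurable
  have scaled: "\<rho> ^ j * a \<le> inner_d d y x - inner_d d c x"
      "inner_d d y x - inner_d d c x \<le> \<rho> ^ j * (a + \<delta>)" if "y \<in> C j" for y j
    using A(3)[of "homothety d c (1 / \<rho> ^ j) y"] that \<rho>(1)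
    by (auto simp: C_def inner_homothety field_simps)
  have C_sub: "C j \<subseteq> K" for j
  proof
    fix y assume y: "y \<in> C j"
    have "homothety d c (\<rho> ^ j) (homothety d c (1 / \<rho> ^ j) y) \<in> K"
      by (rule star) (use A(2) \<rho> y in \<open>auto simp: C_def power_le_one\<close>)
    moreover have "y \<in> extensional {..<d}" using y by (auto simp: C_def space_PiM PiE_def)
    ultimately show "y \<in> K" using homothety_inverse[of "\<rho> ^ j" y d c] \<rho> by simp
  qed
  have sep: False if "j < l" "y \<in> C j" "y \<in> C l" for j l y
  proof -
    have "\<rho> ^ l * (a + \<delta>) \<le> \<rho> ^ Suc j * (a + \<delta>)"
      using that \<rho> a \<delta> by (intro mult_right_mono power_decreasing) auto
    also have "\<dots> < \<rho> ^ j * a" using \<rho> by (simp add: mult.assoc)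
    finally show False using scaled[OF that(2)] scaled[OF that(3)] by linarith
  qed
  have disj: "disjoint_family_on C {..<5}"
    unfolding disjoint_family_on_def using sep by (metis disjoint_iff nat_neq_iff)
  have fin: "emeasure ?M (C j) \<noteq> \<infinity>" for j
    using emeasure_mono[OF C_sub K(1), of j] K(2) by auto
  have low: "4 / 5 * measure ?M A \<le> measure ?M (C j)" if "j < 5" for j
  proof -
    \<comment> \<open>The smallest copy, \<open>j = 4\<close>, scales volume by
      \<open>\<rho> ^ (4 * d)\<close>; Bernoulli and \<open>40 * real d * \<delta> \<le> a\<close>
      keep this factor above 4/5.\<close>
    have "4 / 5 \<le> 1 + real (d * 4) * (\<rho> - 1)"
    proof -
      have "real (d * 4) * (1 - \<rho>) = 8 * real d * \<delta> / (a + 2 * \<delta>)"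
        using a \<delta> by (simp add: \<rho>_def field_simps)
      also have "\<dots> \<le> 1 / 5" using a \<delta> by (simp add: field_simps)
      finally show ?thesis by (simp add: algebra_simps)
    qed
    also have "\<dots> \<le> (1 + (\<rho> - 1)) ^ (d * 4)"
      by (rule Bernoulli_inequality) (use \<rho> in auto)
    also have "\<dots> \<le> \<rho> ^ (j * d)"
      using \<rho> that by (auto intro!: power_decreasing simp: mult.commute)
    finally have "4 / 5 \<le> (\<rho> ^ j) ^ d" by (simp add: power_mult)
    then have "4 / 5 * measure ?M A \<le> (\<rho> ^ j) ^ d * measure ?M A"
      by (intro mult_right_mono) auto
    also have "\<dots> = measure ?M (C j)"
      unfolding C_def by (rule measure_homothety_vimage[symmetric]) (use \<rho> A in auto)
    finally show ?thesis .
  qed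
  have "4 * measure ?M A = (\<Sum>j<5::nat. 4 / 5 * measure ?M A)" by simp
  also have "\<dots> \<le> (\<Sum>j<5::nat. measure ?M (C j))" by (rule sum_mono) (use low in auto)
  also have "\<dots> = measure ?M (\<Union>j<5. C j)"
    by (rule measure_finite_Union[symmetric]) (use C_meas disj fin in auto)
  also have "\<dots> \<le> measure ?M K"
    by (rule measure_mono_fmeasurable) (use C_sub C_meas K in \<open>auto simp: fmeasurable_def\<close>)
  finally show ?thesis .
qed

section \<open>Fattened knowledge sets\<close>

lemma inner_ball_le_1:
  assumes "in_ball d v" "in_ball d x"
  shows "\<bar>inner_d d v x\<bar> \<le> 1"
proof -
  have "\<bar>a * b\<bar> \<le> (a\<^sup>2 + b\<^sup>2) / 2" for a b :: real
    using zero_le_power2[of "\<bar>a\<bar> - \<bar>b\<bar>"] by (simp add: power2_diff abs_mult)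
  then have "\<bar>inner_d d v x\<bar> \<le> (\<Sum>i<d. ((v i)\<^sup>2 + (x i)\<^sup>2) / 2)"
    unfolding inner_d_def by (intro order_trans[OF sum_abs] sum_mono)
  also have "\<dots> = ((\<Sum>i<d. (v i)\<^sup>2) + (\<Sum>i<d. (x i)\<^sup>2)) / 2"
    by (simp add: sum.distrib sum_divide_distrib add_divide_distrib)
  also have "\<dots> \<le> 1" using assms by (simp add: in_ball_def)
  finally show ?thesis .
qed

lemma in_ball_coordinate_le_1:
  assumes "in_ball d x" "i < d"
  shows "\<bar>x i\<bar> \<le> 1"
proof -
  have "(x i)\<^sup>2 \<le> (\<Sum>i<d. (x i)\<^sup>2)"
    using assms(2) by (intro member_le_sum) auto
  then show ?thesis using assms(1) by (metis abs_square_le_1 in_ball_def order_trans)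
qed

text \<open>\<open>lo\<close> and \<open>hi\<close> bound the valuations of \<open>x\<close> that
  \<open>S\<close> still allows. They are informative only for nonempty bounded \<open>S\<close>,
  hence the witnesses and ball hypotheses below.\<close>

definition lo :: "nat \<Rightarrow> (nat \<Rightarrow> real) set \<Rightarrow> (nat \<Rightarrow> real) \<Rightarrow> real" where
  "lo d S x = (INF v\<in>S. inner_d d v x)"

definition hi :: "nat \<Rightarrow> (nat \<Rightarrow> real) set \<Rightarrow> (nat \<Rightarrow> real) \<Rightarrow> real" where
  "hi d S x = (SUP v\<in>S. inner_d d v x)"

abbreviation width :: "nat \<Rightarrow> (nat \<Rightarrow> real) set \<Rightarrow> (nat \<Rightarrow> real) \<Rightarrow> real" where
  "width d S x \<equiv> hi d S x - lo d S x"

lemma bdd_inner: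
  assumes "S \<subseteq> Collect (in_ball d)" "in_ball d x"
  shows "bdd_below ((\<lambda>v. inner_d d v x) ` S)" "bdd_above ((\<lambda>v. inner_d d v x) ` S)"
  using assms inner_ball_le_1[of d _ x]
  by (auto intro!: bdd_belowI2[of _ "-1"] bdd_aboveI2[of _ _ 1] simp: abs_le_iff subset_iff)

lemma lo_le_inner:
  assumes "S \<subseteq> Collect (in_ball d)" "in_ball d x" "v \<in> S"
  shows "lo d S x \<le> inner_d d v x"
  unfolding lo_def by (rule cINF_lower[OF bdd_inner(1)[OF assms(1,2)] assms(3)])

lemma inner_le_hi:
  assumes "S \<subseteq> Collect (in_ball d)" "in_ball d x" "v \<in> S"
  shows "inner_d d v x \<le> hi d S x"
  unfolding hi_def by (rule cSUP_upper[OF assms(3) bdd_inner(2)[OF assms(1,2)]])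

lemma lo_hi_bounds:
  assumes "S \<subseteq> Collect (in_ball d)" "in_ball d x" "v \<in> S"
  shows "-1 \<le> lo d S x" "hi d S x \<le> 1"
  using assms inner_ball_le_1[of d _ x]
  by (auto simp: lo_def hi_def abs_le_iff subset_iff intro!: cINF_greatest cSUP_least)

lemma lo_hi_subset:
  assumes "S \<subseteq> Collect (in_ball d)" "in_ball d x" "v \<in> S'" "S' \<subseteq> S"
  shows "lo d S x \<le> lo d S' x" "hi d S' x \<le> hi d S x"
  unfolding lo_def hi_def using assms bdd_inner[OF assms(1,2)]
  by (auto intro!: cINF_superset_mono cSUP_subset_mono)

text \<open>A polyhedral substitute for the Minkowski sum of \<open>S\<close> with a ball of radius \<open>z\<close>: the support
  constraints of \<open>S\<close> are imposed only in the finitely many directions \<open>X\<close>, which makes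
  measurability immediate.\<close>

definition fatten :: "nat \<Rightarrow> real \<Rightarrow> (nat \<Rightarrow> real) set \<Rightarrow> (nat \<Rightarrow> real) set \<Rightarrow> (nat \<Rightarrow> real) set" where
  "fatten d z X S = {y \<in> Pi\<^sub>E {..<d} (\<lambda>_. {-2..2}).
     \<forall>x\<in>X. lo d S x - z \<le> inner_d d y x \<and> inner_d d y x \<le> hi d S x + z}"

abbreviation vol :: "nat \<Rightarrow> (nat \<Rightarrow> real) set \<Rightarrow> real" where
  "vol d A \<equiv> measure (lebesgue_d d) A"

lemma inner_measurable [measurable]: "(\<lambda>y. inner_d d y x) \<in> borel_measurable (lebesgue_d d)"
  unfolding inner_d_def by measurable

lemma cube_measure:
  assumes "\<And>i. i < d \<Longrightarrow> l i \<le> (u i :: real)"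
  shows "Pi\<^sub>E {..<d} (\<lambda>i. {l i..u i}) \<in> sets (lebesgue_d d)"
    and "emeasure (lebesgue_d d) (Pi\<^sub>E {..<d} (\<lambda>i. {l i..u i})) = ennreal (\<Prod>i<d. u i - l i)"
proof -
  show "Pi\<^sub>E {..<d} (\<lambda>i. {l i..u i}) \<in> sets (lebesgue_d d)"
    by (rule sets_PiM_I_finite) auto
  have "emeasure (lebesgue_d d) (Pi\<^sub>E {..<d} (\<lambda>i. {l i..u i})) = (\<Prod>i<d. emeasure lborel {l i..u i})"
    by (rule lborel_prod.emeasure_PiM) auto
  also have "\<dots> = (\<Prod>i<d. ennreal (u i - l i))"
    using assms by (intro prod.cong) auto
  also have "\<dots> = ennreal (\<Prod>i<d. u i - l i)"
    using assms by (intro prod_ennreal) auto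
  finally show "emeasure (lebesgue_d d) (Pi\<^sub>E {..<d} (\<lambda>i. {l i..u i})) = ennreal (\<Prod>i<d. u i - l i)" .
qed

lemma fatten_sets [measurable]:
  assumes "finite X"
  shows "fatten d z X S \<in> sets (lebesgue_d d)"
proof -
  have "fatten d z X S = Pi\<^sub>E {..<d} (\<lambda>_. {-2..2}) \<inter>
     {y \<in> space (lebesgue_d d). \<forall>x\<in>X. lo d S x - z \<le> inner_d d y x \<and> inner_d d y x \<le> hi d S x + z}"
    by (auto simp: fatten_def space_PiM PiE_iff extensional_def)
  also have "\<dots> \<in> sets (lebesgue_d d)"
    using assms by (intro sets.Int cube_measure) (auto intro!: sets.sets_Collect_finite_All')
  finally show ?thesis .
qed

lemma fatten_emeasure_le: "emeasure (lebesgue_d d) (fatten d z X S) \<le> ennreal (4 ^ d)"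
proof -
  have "emeasure (lebesgue_d d) (fatten d z X S) \<le> emeasure (lebesgue_d d) (Pi\<^sub>E {..<d} (\<lambda>_. {-2..2}))"
    by (rule emeasure_mono) (use cube_measure[of d "\<lambda>_. -2" "\<lambda>_. 2"] in \<open>auto simp: fatten_def\<close>)
  also have "\<dots> = ennreal (4 ^ d)" by (simp add: cube_measure)
  finally show ?thesis .
qed

lemma fatten_fmeasurable:
  assumes "finite X"
  shows "fatten d z X S \<in> fmeasurable (lebesgue_d d)"
  using fatten_sets[OF assms] fatten_emeasure_le[of d z X S]
  by (auto simp: fmeasurable_def intro: le_less_trans)

lemma fatten_restrict_fmeasurable:
  assumes "finite X" and [measurable]: "Measurable.pred borel P"
  shows "{y \<in> fatten d z X S. P (inner_d d y x)} \<in> fmeasurable (lebesgue_d d)"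
proof -
  note K = fatten_fmeasurable[OF assms(1), of d z S]
  have "{y \<in> fatten d z X S. P (inner_d d y x)}
      = fatten d z X S \<inter> {y \<in> space (lebesgue_d d). P (inner_d d y x)}"
    using fmeasurableD[OF K] sets.sets_into_space by blast
  also have "\<dots> \<in> fmeasurable (lebesgue_d d)"
    using K by (intro fmeasurable_Int_fmeasurable) auto
  finally show ?thesis .
qed

lemma vol_fatten_le: "vol d (fatten d z X S) \<le> 4 ^ d"
  using enn2real_mono[OF fatten_emeasure_le[of d z X S]] by (simp add: measure_def)

text \<open>The cube of half-side \<open>z / d\<close> around \<open>s\<close> fits inside:
  coordinates of a direction in the ball are at most 1 in modulus, so inner products move by at most
  \<open>z\<close>.\<close>

lemma vol_fatten_ge:
  assumes S: "S \<subseteq> Collect (in_ball d)" "s \<in> S" and X: "X \<subseteq> Collect (in_ball d)" "finite X"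
    and z: "0 < z" "z \<le> 1" and d: "d \<ge> 1"
  shows "(2 * z / real d) ^ d \<le> vol d (fatten d z X S)"
proof -
  define r where "r = z / real d"
  have r: "0 < r" "r \<le> 1" "real d * r = z"
    using z d by (auto simp: r_def field_simps)
  let ?Q = "Pi\<^sub>E {..<d} (\<lambda>i. {s i - r..s i + r})"
  have s: "in_ball d s" using S by auto
  have "?Q \<subseteq> fatten d z X S"
  proof
    fix y assume y: "y \<in> ?Q"
    have close: "\<bar>y i - s i\<bar> \<le> r" if "i < d" for i
      using PiE_mem[OF y, of i] that by (auto simp: abs_le_iff)
    have "\<bar>inner_d d y x - inner_d d s x\<bar> \<le> z" if "x \<in> X" for x
    proof -
      have x: "in_ball d x" using that X by auto
      have "\<bar>inner_d d y x - inner_d d s x\<bar> = \<bar>\<Sum>i<d. (y i - s i) * x i\<bar>"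
        by (simp add: inner_d_def sum_subtractf algebra_simps)
      also have "\<dots> \<le> (\<Sum>i<d. \<bar>(y i - s i) * x i\<bar>)" by (rule sum_abs)
      also have "\<dots> \<le> (\<Sum>i<d. r * 1)"
        unfolding abs_mult using close in_ball_coordinate_le_1[OF x] r
        by (intro sum_mono mult_mono) auto
      finally show ?thesis using r by simp
    qed
    moreover have "lo d S x \<le> inner_d d s x \<and> inner_d d s x \<le> hi d S x" if "x \<in> X" for x
      using lo_le_inner[of S d x s] inner_le_hi[of S d x s] S X that by auto
    moreover have "y i \<in> {-2..2}" if "i < d" for i
      using close[OF that] in_ball_coordinate_le_1[OF s that] r by auto
    ultimately show "y \<in> fatten d z X S"
      using y by (force simp: fatten_def PiE_iff abs_le_iff)
  qed
  then have "vol d ?Q \<le> vol d (fatten d z X S)"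
    using cube_measure(1)[of d "\<lambda>i. s i - r" "\<lambda>i. s i + r"] r fatten_fmeasurable[OF X(2)]
    by (intro measure_mono_fmeasurable) auto
  moreover have "vol d ?Q = (2 * r) ^ d"
    using cube_measure(2)[of d "\<lambda>i. s i - r" "\<lambda>i. s i + r"] r by (simp add: measure_def)
  ultimately show ?thesis by (simp add: r_def)
qed

text \<open>More directions and a smaller knowledge set both tighten the constraints, so fattenings
  shrink as the learner proceeds.\<close>

lemma fatten_mono:
  assumes "S \<subseteq> Collect (in_ball d)" "X' \<subseteq> Collect (in_ball d)" "s \<in> S'" "S' \<subseteq> S" "X \<subseteq> X'"
  shows "fatten d z X' S' \<subseteq> fatten d z X S"
proof
  fix y assume y: "y \<in> fatten d z X' S'"
  have "lo d S x - z \<le> inner_d d y x \<and> inner_d d y x \<le> hi d S x + z" if "x \<in> X" for x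
    using y lo_hi_subset[of S d x s S'] assms that by (fastforce simp: fatten_def)
  then show "y \<in> fatten d z X S" using y by (auto simp: fatten_def)
qed

lemma convex_combination_bounds:
  fixes a b k l u :: real
  assumes "l \<le> a" "a \<le> u" "l \<le> b" "b \<le> u" "0 \<le> k" "k \<le> 1"
  shows "l \<le> a + k * (b - a)" "a + k * (b - a) \<le> u"
proof -
  have "(1 - k) * l + k * l \<le> (1 - k) * a + k * b" "(1 - k) * a + k * b \<le> (1 - k) * u + k * u"
    using assms by (intro add_mono mult_left_mono; simp)+
  then show "l \<le> a + k * (b - a)" "a + k * (b - a) \<le> u" by (simp_all add: algebra_simps)
qed

text \<open>All constraints are linear bounds that \<open>v\<close> itself satisfies. This provides
  the hypothesis \<open>star\<close> of \<open>slab_volume_le\<close> for every centre in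
  \<open>S\<close>.\<close>

lemma fatten_star_shaped:
  assumes S: "S \<subseteq> Collect (in_ball d)" "v \<in> S" and X: "X \<subseteq> Collect (in_ball d)" and "0 \<le> z"
    and y: "y \<in> fatten d z X S" and k: "0 \<le> k" "k \<le> 1"
  shows "homothety d v k y \<in> fatten d z X S"
proof -
  have "homothety d v k y i \<in> {-2..2}" if "i < d" for i
    using convex_combination_bounds[of "-2" "v i" 2 "y i" k] y k that
      in_ball_coordinate_le_1[of d v i] S
    by (auto simp: fatten_def homothety_def PiE_iff)
  moreover have "lo d S x - z \<le> inner_d d (homothety d v k y) x \<and>
      inner_d d (homothety d v k y) x \<le> hi d S x + z" if "x \<in> X" for x
    unfolding inner_homothety
    using convex_combination_bounds[of "lo d S x - z" "inner_d d v x" "hi d S x + z" "inner_d d y x" k]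
      y k that lo_le_inner[of S d x v] inner_le_hi[of S d x v] S X \<open>0 \<le> z\<close>
    by (fastforce simp: fatten_def)
  moreover have "homothety d v k y \<in> extensional {..<d}"
    by (simp add: homothety_def)
  ultimately show ?thesis by (simp add: fatten_def PiE_iff)
qed

text \<open>Shrink the slab towards a vector of \<open>S\<close> that is nearly extremal in
  direction \<open>x\<close>, at whichever end is farther from \<open>p\<close>.\<close>

lemma fatten_slab_volume_le:
  assumes S: "S \<subseteq> Collect (in_ball d)" "v \<in> S" and X: "X \<subseteq> Collect (in_ball d)" "finite X"
    and x: "in_ball d x" and z: "0 < z" and d: "d \<ge> 1" and w: "324 * (real d * z) \<le> width d S x"
  shows "4 * vol d {y \<in> fatten d z X S. p - z \<le> inner_d d y x \<and> inner_d d y x \<le> p + z}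
       \<le> vol d (fatten d z X S)"
proof -
  let ?K = "fatten d z X S"
  let ?A = "{y \<in> ?K. p - z \<le> inner_d d y x \<and> inner_d d y x \<le> p + z}"
  let ?w = "width d S x"
  have w0: "0 < ?w" using w z d by (smt (verit) mult_pos_pos of_nat_0_less_iff zero_less_one less_le_trans)
  have "1 * z \<le> real d * z" using d z by (intro mult_right_mono) auto
  \<comment> \<open>With \<open>a > w / 4 - z\<close> and \<open>\<delta> = 2 * z\<close>, the
    condition \<open>40 * d * \<delta> \<le> a\<close> follows from
    \<open>w \<ge> 320 * d * z + 4 * z\<close>.\<close>
  then have far: "320 * (real d * z) + 4 * z \<le> ?w" and far0: "4 * z < ?w" using w z by - linarith+
  \<comment> \<open>The extrema need not be attained. Giving up a quarter of the width at each end
    leaves \<open>v0\<close> and \<open>v1\<close> more than \<open>w / 2\<close> apart, hence the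
    farther one more than \<open>w / 4\<close> from \<open>p\<close>.\<close>
  obtain v0 where v0: "v0 \<in> S" "inner_d d v0 x < lo d S x + ?w / 4"
    using cInf_lessD[of "(\<lambda>v. inner_d d v x) ` S" "lo d S x + ?w / 4"] S w0 by (auto simp: lo_def)
  obtain v1 where v1: "v1 \<in> S" "hi d S x - ?w / 4 < inner_d d v1 x"
    using less_cSupD[of "(\<lambda>v. inner_d d v x) ` S" "hi d S x - ?w / 4"] S w0 by (auto simp: hi_def)
  have K: "?K \<in> sets (lebesgue_d d)" "emeasure (lebesgue_d d) ?K < \<infinity>"
    using fatten_fmeasurable[OF X(2)] by (auto simp: fmeasurable_def)
  have A: "?A \<in> sets (lebesgue_d d)"
    using fatten_restrict_fmeasurable[OF X(2), of "\<lambda>r. p - z \<le> r \<and> r \<le> p + z" d z S x] by auto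
  show ?thesis
  proof (cases "(inner_d d v0 x + inner_d d v1 x) / 2 \<le> p")
    case True
    show ?thesis
    proof (rule slab_volume_le[where c=v0 and a="p - z - inner_d d v0 x" and \<delta>="2 * z" and x=x])
      show "homothety d v0 k y \<in> ?K" if "y \<in> ?K" "0 \<le> k" "k \<le> 1" for y k
        using fatten_star_shaped[OF S(1) v0(1) X(1) _ that] z by simp
    qed (use True K A far far0 z v0 v1 in \<open>auto simp: field_simps\<close>)
  next
    case False
    \<comment> \<open>Reversing the direction places the slab on the positive side of the centre
      \<open>v1\<close>.\<close>
    have neg: "inner_d d y (\<lambda>i. - x i) = - inner_d d y x" for y
      by (simp add: inner_d_def sum_negf)
    show ?thesis
    proof (rule slab_volume_le[where c=v1 and a="inner_d d v1 x - p - z" and \<delta>="2 * z" and x="\<lambda>i. - x i"])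
      show "homothety d v1 k y \<in> ?K" if "y \<in> ?K" "0 \<le> k" "k \<le> 1" for y k
        using fatten_star_shaped[OF S(1) v1(1) X(1) _ that] z by simp
    qed (use False K A far far0 z v0 v1 in \<open>auto simp: neg field_simps\<close>)
  qed
qed

section \<open>Balanced cuts and the potential\<close>

text \<open>The shifts by \<open>z\<close> allow for the fattening of a surviving part, which may
  overshoot \<open>p\<close> by \<open>z\<close>. Since \<open>p\<close> divides the fattening, it
  may lie slightly outside \<open>S\<close>'s own interval.\<close>

definition balanced_cut ::
    "nat \<Rightarrow> real \<Rightarrow> (nat \<Rightarrow> real) set \<Rightarrow> (nat \<Rightarrow> real) set \<Rightarrow> (nat \<Rightarrow> real) \<Rightarrow> real \<Rightarrow> bool" where
  "balanced_cut d z X S x p \<longleftrightarrow>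
     lo d S x - 2 * z \<le> p \<and> p \<le> hi d S x + z \<and>
     4 * vol d {y \<in> fatten d z X S. inner_d d y x \<le> p + z} \<le> 3 * vol d (fatten d z X S) \<and>
     4 * vol d {y \<in> fatten d z X S. p - z \<le> inner_d d y x} \<le> 3 * vol d (fatten d z X S)"

text \<open>A discrete intermediate value argument: in steps of \<open>z\<close>, \<open>F\<close>
  passes half the volume, and the thin slab crossed holds at most a quarter. Continuity of
  \<open>F\<close> is thus avoided.\<close>

lemma balanced_cut_exists:
  assumes S: "S \<subseteq> Collect (in_ball d)" "v \<in> S" and X: "X \<subseteq> Collect (in_ball d)" "finite X" "x \<in> X"
    and z: "0 < z" "z \<le> 1" and d: "d \<ge> 1" and w: "324 * (real d * z) \<le> width d S x"
  shows "\<exists>p. balanced_cut d z X S x p"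
proof -
  let ?K = "fatten d z X S"
  define F where "F r = vol d {y \<in> ?K. inner_d d y x \<le> r}" for r
  have "0 < (2 * z / real d) ^ d" using z d by simp
  then have V: "0 < vol d ?K" using vol_fatten_ge[OF S X(1,2) z d] by linarith
  have K: "?K \<in> fmeasurable (lebesgue_d d)" by (rule fatten_fmeasurable[OF X(2)])
  have K_range: "lo d S x - z \<le> inner_d d y x" "inner_d d y x \<le> hi d S x + z" if "y \<in> ?K" for y
    using that X(3) by (auto simp: fatten_def)
  \<comment> \<open>Starting at \<open>lo - 2 * z\<close>, strictly below the fattening, gives
    \<open>F (g 0) = 0\<close>, so the least index past half has a predecessor.\<close>
  define g where "g k = lo d S x - 2 * z + real k * z" for k
  have F_top: "F r = vol d ?K" if "hi d S x + z \<le> r" for r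
    unfolding F_def using K_range(2) that by (intro arg_cong[where f="vol d"]) force
  have g0: "\<not> vol d ?K \<le> 2 * F (g 0)"
  proof -
    have "{y \<in> ?K. inner_d d y x \<le> g 0} = {}"
      using K_range(1) z by (force simp: g_def)
    then show ?thesis using V unfolding F_def by (simp only: measure_empty)
  qed
  obtain k where "(width d S x + 3 * z) / z \<le> real k" using real_arch_simple by blast
  then have "hi d S x + z \<le> g k" using z by (simp add: g_def field_simps)
  then have ex: "vol d ?K \<le> 2 * F (g k)" using F_top V by simp
  define m where "m = (LEAST k. vol d ?K \<le> 2 * F (g k))"
  have m: "vol d ?K \<le> 2 * F (g m)" unfolding m_def by (rule LeastI[where P="\<lambda>k. vol d ?K \<le> 2 * F (g k)", OF ex])
  obtain l where l: "m = Suc l" using m g0 by (cases m) auto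
  have l': "2 * F (g l) < vol d ?K"
    using not_less_Least[of l "\<lambda>k. vol d ?K \<le> 2 * F (g k)"] l by (simp add: m_def)
  define p where "p = g l"
  have up: "vol d ?K \<le> 2 * F (p + z)" using m l by (simp add: p_def g_def algebra_simps)
  note meas = fatten_restrict_fmeasurable[OF X(2), of _ d z S x]
  note sub = meas[of "\<lambda>r. r \<le> p"] meas[of "\<lambda>r. r \<le> p + z"] meas[of "\<lambda>r. p - z \<le> r"]
    meas[of "\<lambda>r. p + z < r"] meas[of "\<lambda>r. p - z \<le> r \<and> r \<le> p + z"]
  let ?slab = "{y \<in> ?K. p - z \<le> inner_d d y x \<and> inner_d d y x \<le> p + z}"
  have slab: "4 * vol d ?slab \<le> vol d ?K"
    by (rule fatten_slab_volume_le[OF S X(1,2) _ z(1) d w]) (use X in auto)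
  have "F (p + z) \<le> F p + vol d ?slab"
  proof -
    have "F (p + z) \<le> vol d ({y \<in> ?K. inner_d d y x \<le> p} \<union> ?slab)"
      unfolding F_def
      by (rule measure_mono_fmeasurable) (use sub z in \<open>auto intro!: fmeasurable.Un\<close>)
    also have "\<dots> \<le> F p + vol d ?slab"
      unfolding F_def by (rule measure_Un_le) (use sub in auto)
    finally show ?thesis .
  qed
  moreover have "vol d {y \<in> ?K. p - z \<le> inner_d d y x} \<le> vol d ?slab + (vol d ?K - F (p + z))"
  proof -
    have "vol d {y \<in> ?K. p - z \<le> inner_d d y x} \<le> vol d (?slab \<union> {y \<in> ?K. p + z < inner_d d y x})"
      by (rule measure_mono_fmeasurable) (use sub z in \<open>auto intro!: fmeasurable.Un\<close>)
    also have "\<dots> \<le> vol d ?slab + vol d {y \<in> ?K. p + z < inner_d d y x}"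
      by (rule measure_Un_le) (use sub in auto)
    also have "{y \<in> ?K. p + z < inner_d d y x} = ?K - {y \<in> ?K. inner_d d y x \<le> p + z}" by auto
    also have "vol d \<dots> = vol d ?K - F (p + z)"
      unfolding F_def by (rule measurable_measure_Diff) (use K sub in auto)
    finally show ?thesis .
  qed
  moreover have "p \<le> hi d S x + z" using F_top[of p] l' V by (force simp: p_def)
  moreover have "lo d S x - 2 * z \<le> p" using z by (simp add: p_def g_def)
  ultimately have "balanced_cut d z X S x p"
    using slab up l' by (simp add: balanced_cut_def F_def p_def)
  then show ?thesis ..
qed

section \<open>Dyadic scales and the weighted log-volume potential\<close>

definition scale :: "real \<Rightarrow> nat" where
  "scale w = (LEAST i. (1 / 2) ^ i < w)"

lemma scale_bounds:
  assumes "0 < w" "w \<le> 2"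
  shows "(1 / 2) ^ scale w < w" "w \<le> 2 * (1 / 2) ^ scale w"
proof -
  obtain i :: nat where i: "(1 / 2) ^ i < w" using real_arch_pow_inv[of w "1 / 2"] assms by auto
  show "(1 / 2) ^ scale w < w" unfolding scale_def by (rule LeastI[where P="\<lambda>i. (1 / 2) ^ i < w", OF i])
  show "w \<le> 2 * (1 / 2) ^ scale w"
  proof (cases "scale w")
    case (Suc j)
    then have "\<not> (1 / 2) ^ j < w"
      using not_less_Least[of j "\<lambda>i. (1 / 2) ^ i < w"] by (simp add: scale_def)
    then show ?thesis by (simp add: Suc)
  qed (use assms in simp)
qed

text \<open>The constant 400 exceeds the 324 of the slab bound. The radius depends on the scale
  only, so one fixed family of fattenings serves all rounds.\<close>

definition radius :: "nat \<Rightarrow> nat \<Rightarrow> real" where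
  "radius d i = (1 / 2) ^ i / (400 * real d)"

lemma radius_bounds:
  assumes "d \<ge> 1"
  shows "0 < radius d i" "radius d i \<le> (1 / 2) ^ i / 400" "radius d i \<le> 1"
    "324 * (real d * radius d i) \<le> (1 / 2) ^ i"
proof -
  have "(1 / 2 :: real) ^ i \<le> 1" by (simp add: power_le_one)
  moreover have "radius d i \<le> (1 / 2) ^ i / 400"
    unfolding radius_def using assms by (intro divide_left_mono) auto
  ultimately show "radius d i \<le> (1 / 2) ^ i / 400" "radius d i \<le> 1" by linarith+
  show "0 < radius d i" "324 * (real d * radius d i) \<le> (1 / 2) ^ i"
    using assms by (auto simp: radius_def)
qed

text \<open>\<open>X\<close> is meant to contain \<open>x\<close> already: existence of a balanced
  cut relies on that constraint, so callers pass \<open>insert x X\<close>.\<close>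

definition cut :: "nat \<Rightarrow> (nat \<Rightarrow> real) set \<Rightarrow> (nat \<Rightarrow> real) set \<Rightarrow> (nat \<Rightarrow> real) \<Rightarrow> real" where
  "cut d X S x = (SOME p. balanced_cut d (radius d (scale (width d S x))) X S x p)"

text \<open>The weight at scale \<open>i\<close> is comparable to the widths of that scale, so a
  constant drop of the logarithm pays for such a width. The cutoff \<open>n\<close> belongs to the
  analysis; the learner does not know it.\<close>

definition potential :: "nat \<Rightarrow> nat \<Rightarrow> (nat \<Rightarrow> real) set \<Rightarrow> (nat \<Rightarrow> real) set \<Rightarrow> real" where
  "potential d n X S = (\<Sum>i<n. (1 / 2) ^ i * ln (vol d (fatten d (radius d i) X S)))"

lemma vol_fatten_pos:
  assumes "S \<subseteq> Collect (in_ball d)" "s \<in> S" "X \<subseteq> Collect (in_ball d)" "finite X" "d \<ge> 1"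
  shows "0 < vol d (fatten d (radius d i) X S)"
proof -
  have "0 < (2 * radius d i / real d) ^ d" using radius_bounds[OF assms(5)] assms(5) by simp
  also have "\<dots> \<le> vol d (fatten d (radius d i) X S)"
    using radius_bounds[OF assms(5)] assms by (intro vol_fatten_ge)
  finally show ?thesis .
qed

lemma vol_fatten_mono:
  assumes "S \<subseteq> Collect (in_ball d)" "s \<in> S'" "S' \<subseteq> S"
    and "X' \<subseteq> Collect (in_ball d)" "finite X'" "X \<subseteq> X'"
  shows "vol d (fatten d z X' S') \<le> vol d (fatten d z X S)"
  using fatten_mono[of S d X' s S' X z] assms finite_subset[of X X']
  by (intro measure_mono_fmeasurable fatten_fmeasurable) (auto intro: fatten_sets)

lemma potential_mono:
  assumes "S \<subseteq> Collect (in_ball d)" "s \<in> S'" "S' \<subseteq> S"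
    and "X' \<subseteq> Collect (in_ball d)" "finite X'" "X \<subseteq> X'" "d \<ge> 1"
  shows "potential d n X' S' \<le> potential d n X S"
  unfolding potential_def
proof (intro sum_mono mult_left_mono)
  fix i
  have "0 < vol d (fatten d (radius d i) X' S')"
    using assms by (intro vol_fatten_pos[where s=s]) auto
  then show "ln (vol d (fatten d (radius d i) X' S')) \<le> ln (vol d (fatten d (radius d i) X S))"
    using vol_fatten_mono[OF assms(1-6), of "radius d i"] by (intro ln_mono) auto
qed simp

lemma cut_bounds:
  assumes S: "S \<subseteq> Collect (in_ball d)" "v \<in> S" and X: "X \<subseteq> Collect (in_ball d)" "finite X"
    and x: "in_ball d x" and w: "0 < width d S x" and d: "d \<ge> 1"
  shows "balanced_cut d (radius d (scale (width d S x))) (insert x X) S x (cut d (insert x X) S x)"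
    and "lo d S x - width d S x \<le> cut d (insert x X) S x"
    and "cut d (insert x X) S x \<le> hi d S x + width d S x"
proof -
  let ?z = "radius d (scale (width d S x))"
  have "width d S x \<le> 2" using lo_hi_bounds[OF S(1) x S(2)] by simp
  note sc = scale_bounds[OF w this]
  note rb = radius_bounds[OF d, of "scale (width d S x)"]
  show *: "balanced_cut d ?z (insert x X) S x (cut d (insert x X) S x)"
    unfolding cut_def
    by (rule someI_ex, rule balanced_cut_exists[OF S]) (use X x d sc rb in auto)
  have "2 * ?z \<le> width d S x" using sc rb by linarith
  then show "lo d S x - width d S x \<le> cut d (insert x X) S x"
    "cut d (insert x X) S x \<le> hi d S x + width d S x"
    using * rb unfolding balanced_cut_def by linarith+
qed

text \<open>As \<open>x\<close> is now among the directions, the fattening of \<open>S'\<close> lies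
  within \<open>z\<close> of one side of the cut and loses a quarter of its volume. The factor 8
  combines a log drop of 1/4 with \<open>w \<le> 2 * (1 / 2) ^ i\<close>.\<close>

lemma cut_decreases_potential:
  assumes S: "S \<subseteq> Collect (in_ball d)" and S': "s \<in> S'" "S' \<subseteq> S"
    and X: "X \<subseteq> Collect (in_ball d)" "finite X"
    and x: "in_ball d x" and w: "0 < width d S x" and d: "d \<ge> 1" and n: "scale (width d S x) < n"
    and side: "(\<forall>v\<in>S'. inner_d d v x \<le> cut d (insert x X) S x) \<or>
               (\<forall>v\<in>S'. cut d (insert x X) S x \<le> inner_d d v x)"
  shows "width d S x \<le> 8 * (potential d n X S - potential d n (insert x X) S')"
proof -
  let ?i = "scale (width d S x)"
  let ?X = "insert x X"
  let ?p = "cut d ?X S x"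
  define V where "V i = vol d (fatten d (radius d i) X S)" for i
  define V' where "V' i = vol d (fatten d (radius d i) ?X S')" for i
  have s: "s \<in> S" using S' by auto
  have X': "?X \<subseteq> Collect (in_ball d)" "finite ?X" using X x by auto
  have S'b: "S' \<subseteq> Collect (in_ball d)" using S S' by auto
  note bal = cut_bounds(1)[OF S s X x w d]
  have V'pos: "0 < V' i" for i
    unfolding V'_def using S'b S'(1) X' d by (intro vol_fatten_pos)
  have le: "V' i \<le> V i" for i
    unfolding V'_def V_def using S S' X' by (intro vol_fatten_mono) auto
  have "width d S x \<le> 2" using lo_hi_bounds[OF S x s] by simp
  note sc = scale_bounds[OF w this]
  have sub: "fatten d z ?X S' \<subseteq> fatten d z ?X S" for z
    by (rule fatten_mono) (use S S' X' in auto)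
  note fm = fatten_restrict_fmeasurable[OF X'(2), of _ d "radius d ?i" S x]
  have fatten_bounds: "lo d S' x - z \<le> inner_d d y x \<and> inner_d d y x \<le> hi d S' x + z"
    if "y \<in> fatten d z ?X S'" for y z
    using that by (simp add: fatten_def)
  have "4 * V' ?i \<le> 3 * vol d (fatten d (radius d ?i) ?X S)"
    using side
  proof
    assume "\<forall>v\<in>S'. inner_d d v x \<le> ?p"
    then have "hi d S' x \<le> ?p" unfolding hi_def using S' by (intro cSUP_least) auto
    then have "V' ?i \<le> vol d {y \<in> fatten d (radius d ?i) ?X S. inner_d d y x \<le> ?p + radius d ?i}"
      unfolding V'_def using sub fm[of "\<lambda>r. r \<le> ?p + radius d ?i"] fatten_sets[OF X'(2)]
      by (intro measure_mono_fmeasurable) (auto dest: fatten_bounds)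
    then show ?thesis using bal by (simp add: balanced_cut_def)
  next
    assume "\<forall>v\<in>S'. ?p \<le> inner_d d v x"
    then have "?p \<le> lo d S' x" unfolding lo_def using S' by (intro cINF_greatest) auto
    then have "V' ?i \<le> vol d {y \<in> fatten d (radius d ?i) ?X S. ?p - radius d ?i \<le> inner_d d y x}"
      unfolding V'_def using sub fm[of "\<lambda>r. ?p - radius d ?i \<le> r"] fatten_sets[OF X'(2)]
      by (intro measure_mono_fmeasurable) (auto dest: fatten_bounds)
    then show ?thesis using bal by (simp add: balanced_cut_def)
  qed
  also have "\<dots> \<le> 3 * V ?i"
    unfolding V_def using vol_fatten_mono[OF S s subset_refl X' subset_insertI] by simp
  finally have q: "V' ?i \<le> 3 / 4 * V ?i" by simp
  have Vpos: "0 < V i" for i using V'pos[of i] le[of i] by linarith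
  have "ln (V' ?i) \<le> ln (3 / 4 * V ?i)" using q V'pos by (intro ln_mono) auto
  also have "\<dots> = ln (3 / 4) + ln (V ?i)" by (rule ln_mult_pos) (use Vpos[of ?i] in auto)
  also have "\<dots> \<le> ln (V ?i) - 1 / 4" using ln_le_minus_one[of "3 / 4 :: real"] by simp
  finally have drop: "1 / 4 \<le> ln (V ?i) - ln (V' ?i)" by simp
  have "(1 / 2) ^ ?i * (1 / 4) \<le> (1 / 2) ^ ?i * (ln (V ?i) - ln (V' ?i))"
    using drop by (intro mult_left_mono) auto
  \<comment> \<open>The other scales contribute nonnegative terms, because fattenings only
    shrink.\<close>
  also have "\<dots> \<le> (\<Sum>i<n. (1 / 2) ^ i * (ln (V i) - ln (V' i)))"
    using le V'pos n
    by (intro member_le_sum[where f="\<lambda>i. (1 / 2) ^ i * (ln (V i) - ln (V' i))"])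
       (auto intro!: mult_nonneg_nonneg ln_mono)
  also have "\<dots> = potential d n X S - potential d n ?X S'"
    by (simp add: potential_def V_def V'_def sum_subtractf algebra_simps)
  finally have "8 * ((1 / 2) ^ ?i * (1 / 4)) \<le> 8 * (potential d n X S - potential d n ?X S')"
    by (intro mult_left_mono) auto
  moreover have "width d S x \<le> 8 * ((1 / 2) ^ ?i * (1 / 4))" using sc by simp
  ultimately show ?thesis by (rule order_trans[rotated])
qed

section \<open>The learner\<close>

text \<open>The learner's state is \<open>(X, S, B)\<close>: the contexts seen so far and the sets of seller and buyer
  vectors consistent with the feedback.\<close>

type_synonym knowledge = "(nat \<Rightarrow> real) set \<times> (nat \<Rightarrow> real) set \<times> (nat \<Rightarrow> real) set"

definition undecided :: "nat \<Rightarrow> (nat \<Rightarrow> real) set \<Rightarrow> (nat \<Rightarrow> real) set \<Rightarrow> (nat \<Rightarrow> real) \<Rightarrow> bool" where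
  "undecided d S B x \<longleftrightarrow> lo d B x < hi d S x \<and> lo d S x < hi d B x"

text \<open>While trading is undecided, the wider of the two intervals is cut, and the other party is offered
  a price that it certainly accepts, so that the single feedback bit is unambiguous.\<close>

fun post :: "nat \<Rightarrow> knowledge \<Rightarrow> (nat \<Rightarrow> real) \<Rightarrow> real \<times> real" where
  "post d (X, S, B) x =
     (if hi d S x \<le> lo d B x then (hi d S x, lo d B x)
      else if hi d B x \<le> lo d S x then (lo d S x - 1, hi d B x + 1)
      else if width d S x \<le> width d B x then (hi d S x, cut d (insert x X) B x)
      else (cut d (insert x X) S x, lo d B x))"

text \<open>In an undecided round exactly one filter is active, that of the party whose interval was
  cut, with ties going to the buyer as in \<open>post\<close>. A decided round only records the
  context.\<close>

fun learn :: "nat \<Rightarrow> knowledge \<Rightarrow> (nat \<Rightarrow> real) \<times> bool \<Rightarrow> knowledge" where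
  "learn d (X, S, B) (x, f) =
     (insert x X,
      {v \<in> S. undecided d S B x \<and> width d B x < width d S x \<longrightarrow>
               (inner_d d v x \<le> cut d (insert x X) S x) = f},
      {v \<in> B. undecided d S B x \<and> width d S x \<le> width d B x \<longrightarrow>
               (cut d (insert x X) B x \<le> inner_d d v x) = f})"

definition knowledge_of :: "nat \<Rightarrow> ((nat \<Rightarrow> real) \<times> bool) list \<Rightarrow> knowledge" where
  "knowledge_of d h = foldl (learn d) ({}, Collect (in_ball d), Collect (in_ball d)) h"

definition learner :: policy where
  "learner d h x = post d (knowledge_of d h) x"

fun sound :: "nat \<Rightarrow> (nat \<Rightarrow> real) \<Rightarrow> (nat \<Rightarrow> real) \<Rightarrow> knowledge \<Rightarrow> bool" where
  "sound d s b (X, S, B) \<longleftrightarrow> finite X \<and> X \<subseteq> Collect (in_ball d) \<and>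
     S \<subseteq> Collect (in_ball d) \<and> B \<subseteq> Collect (in_ball d) \<and> s \<in> S \<and> b \<in> B"

fun total_potential :: "nat \<Rightarrow> nat \<Rightarrow> knowledge \<Rightarrow> real" where
  "total_potential d n (X, S, B) = potential d n X S + potential d n X B"

text \<open>The cutoff of the potential includes the scales of both current widths.\<close>

fun resolves :: "nat \<Rightarrow> nat \<Rightarrow> knowledge \<Rightarrow> (nat \<Rightarrow> real) \<Rightarrow> bool" where
  "resolves d n (X, S, B) x \<longleftrightarrow> scale (width d S x) < n \<and> scale (width d B x) < n"

definition round_regret :: "real \<Rightarrow> real \<Rightarrow> real \<times> real \<Rightarrow> real" where
  "round_regret st bt pq = max 0 (bt - st) - gft st bt pq"

definition round_deficit :: "real \<Rightarrow> real \<Rightarrow> real \<times> real \<Rightarrow> real" where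
  "round_deficit st bt pq = max 0 (- profit st bt pq)"

section \<open>Cost of a single round\<close>

text \<open>A round costs at most three times the larger width, and each unit of width is paid by 8
  units of potential, hence 24.\<close>

lemma round_step:
  fixes d n s b x k
  defines "st \<equiv> inner_d d s x" and "bt \<equiv> inner_d d b x"
  defines "pq \<equiv> post d k x"
  defines "k' \<equiv> learn d k (x, trade st bt pq)"
  assumes d: "d \<ge> 1" and k: "sound d s b k" and x: "in_ball d x"
  shows "sound d s b k'"
    and "resolves d n k x \<Longrightarrow> round_regret st bt pq \<le> 24 * (total_potential d n k - total_potential d n k')"
    and "resolves d n k x \<Longrightarrow> round_deficit st bt pq \<le> 24 * (total_potential d n k - total_potential d n k')"
proof -
  obtain X S B where k_eq: "k = (X, S, B)" by (cases k)
  obtain S' B' where k'_eq: "k' = (insert x X, S', B')" by (simp add: k'_def k_eq)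
  from k have X: "X \<subseteq> Collect (in_ball d)" "finite X" and S: "S \<subseteq> Collect (in_ball d)" "s \<in> S"
    and B: "B \<subseteq> Collect (in_ball d)" "b \<in> B" by (auto simp: k_eq)
  have sb: "lo d S x \<le> st" "st \<le> hi d S x" "lo d B x \<le> bt" "bt \<le> hi d B x"
    unfolding st_def bt_def using lo_le_inner inner_le_hi S B x by auto
  have sub: "S' \<subseteq> S" "B' \<subseteq> B" using k'_eq by (auto simp: k'_def k_eq)
  \<comment> \<open>The party that is not cut accepts its price by \<open>sb\<close>, so the
    feedback bit is the true answer of the other one.\<close>
  have mem: "s \<in> S'" "b \<in> B'"
    using k'_eq S(2) B(2) sb
    by (auto simp: k'_def k_eq pq_def trade_def undecided_def st_def[symmetric] bt_def[symmetric])
  show sound: "sound d s b k'"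
    using k x sub mem by (auto simp: k'_eq k_eq)
  have X': "insert x X \<subseteq> Collect (in_ball d)" "finite (insert x X)" "X \<subseteq> insert x X"
    using X x by auto
  have dropS: "0 \<le> potential d n X S - potential d n (insert x X) S'"
    using potential_mono[OF S(1) mem(1) sub(1) X' d] by simp
  have dropB: "0 \<le> potential d n X B - potential d n (insert x X) B'"
    using potential_mono[OF B(1) mem(2) sub(2) X' d] by simp
  define \<Delta> where "\<Delta> = total_potential d n k - total_potential d n k'"
  have \<Delta>: "\<Delta> = (potential d n X S - potential d n (insert x X) S')
      + (potential d n X B - potential d n (insert x X) B')"
    by (simp add: \<Delta>_def k_eq k'_eq)
  have "round_regret st bt pq \<le> 24 * \<Delta> \<and> round_deficit st bt pq \<le> 24 * \<Delta>" if n: "resolves d n k x"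
  proof (cases "undecided d S B x")
    case False
    \<comment> \<open>Either the trade surely happens, with nonnegative profit and full gain, or the
      price \<open>lo - 1\<close> excludes a trade that has no positive gain.\<close>
    then have "round_regret st bt pq \<le> 0 \<and> round_deficit st bt pq \<le> 0"
      using sb by (auto simp: undecided_def pq_def k_eq round_regret_def round_deficit_def gft_def
          profit_def trade_def)
    then show ?thesis using dropS dropB \<Delta> by linarith
  next
    case u: True
    show ?thesis
    proof (cases "width d S x \<le> width d B x")
      case True
      let ?w = "width d B x"
      \<comment> \<open>Adding the two inequalities of \<open>undecided\<close> shows that the
        widths have positive sum, so the larger is positive.\<close>
      have w: "0 < ?w" using True u by (auto simp: undecided_def)
      have pq: "pq = (hi d S x, cut d (insert x X) B x)"
        using True u by (auto simp: pq_def k_eq undecided_def)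
      have "(\<forall>v\<in>B'. inner_d d v x \<le> cut d (insert x X) B x) \<or>
            (\<forall>v\<in>B'. cut d (insert x X) B x \<le> inner_d d v x)"
        using k'_eq u True by (cases "trade st bt pq") (auto simp: k'_def k_eq)
      then have "?w \<le> 8 * (potential d n X B - potential d n (insert x X) B')"
        using n by (intro cut_decreases_potential[OF B(1) mem(2) sub(2) X x w d]) (auto simp: k_eq)
      then have w\<Delta>: "?w \<le> 8 * \<Delta>" using dropS unfolding \<Delta> by (simp add: algebra_simps)
      note cb = cut_bounds(2,3)[OF B X x w d]
      \<comment> \<open>Overlap of the intervals bounds \<open>\<bar>bt - st\<bar>\<close> and
        \<open>hi d S x - lo d B x\<close> by the sum of the widths, at most \<open>2 * ?w\<close>;
        the cut may lie a further \<open>?w\<close> below \<open>lo d B x\<close>.\<close>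
      have "round_regret st bt pq \<le> 3 * ?w \<and> round_deficit st bt pq \<le> 3 * ?w"
        using sb cb u True w
        by (auto simp: undecided_def pq round_regret_def round_deficit_def gft_def profit_def trade_def)
      then show ?thesis using w\<Delta> by (auto simp: algebra_simps)
    next
      case False
      let ?w = "width d S x"
      have w: "0 < ?w" using False sb by linarith
      have pq: "pq = (cut d (insert x X) S x, lo d B x)"
        using False u by (auto simp: pq_def k_eq undecided_def)
      have "(\<forall>v\<in>S'. inner_d d v x \<le> cut d (insert x X) S x) \<or>
            (\<forall>v\<in>S'. cut d (insert x X) S x \<le> inner_d d v x)"
        using k'_eq u False by (cases "trade st bt pq") (auto simp: k'_def k_eq)
      then have "?w \<le> 8 * (potential d n X S - potential d n (insert x X) S')"
        using n by (intro cut_decreases_potential[OF S(1) mem(1) sub(1) X x w d]) (auto simp: k_eq)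
      then have w\<Delta>: "?w \<le> 8 * \<Delta>" using dropB unfolding \<Delta> by (simp add: algebra_simps)
      note cb = cut_bounds(2,3)[OF S X x w d]
      have "round_regret st bt pq \<le> 3 * ?w \<and> round_deficit st bt pq \<le> 3 * ?w"
        using sb cb u False w
        by (auto simp: undecided_def pq round_regret_def round_deficit_def gft_def profit_def trade_def)
      then show ?thesis using w\<Delta> by (auto simp: algebra_simps)
    qed
  qed
  then show "resolves d n k x \<Longrightarrow> round_regret st bt pq \<le> 24 * (total_potential d n k - total_potential d n k')"
    and "resolves d n k x \<Longrightarrow> round_deficit st bt pq \<le> 24 * (total_potential d n k - total_potential d n k')"
    by (simp_all add: \<Delta>_def)
qed

section \<open>Total potential and summation over rounds\<close>

text \<open>Volumes between \<open>(2 * z / d) ^ d\<close> and \<open>4 ^ d\<close> allow a log drop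
  of order \<open>d * (i + ln (d + 1))\<close> at scale \<open>i\<close>, and the geometric weights
  make the sum bounded independently of \<open>n\<close>.\<close>

lemma potential_drop_le:
  assumes S: "S \<subseteq> Collect (in_ball d)" "s \<in> S" and X: "X \<subseteq> Collect (in_ball d)" "finite X"
    and d: "d \<ge> 1"
  shows "potential d n {} (Collect (in_ball d)) - potential d n X S \<le> 36 * real d * ln (real d + 1)"
proof -
  let ?L = "ln (real d + 1)"
  define V where "V i = vol d (fatten d (radius d i) {} (Collect (in_ball d)))" for i
  define W where "W i = vol d (fatten d (radius d i) X S)" for i
  have step: "ln (V i) - ln (W i) \<le> real d * (7 + 2 * ?L) + real d * real i" for i
  proof -
    note rb = radius_bounds[OF d, of i]
    have "0 < V i" unfolding V_def
      by (rule vol_fatten_pos[where s="\<lambda>_. 0"]) (use d in \<open>auto simp: in_ball_def\<close>)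
    then have "ln (V i) \<le> ln (4 ^ d)"
      using vol_fatten_le by (intro ln_mono) (auto simp: V_def)
    moreover have "ln ((2 * radius d i / real d) ^ d) \<le> ln (W i)"
      unfolding W_def using vol_fatten_ge[OF S X rb(1,3) d] rb d by (intro ln_mono) auto
    ultimately have "ln (V i) - ln (W i) \<le> real d * (ln 4 - ln (2 * radius d i / real d))"
      using rb d by (simp add: ln_realpow algebra_simps)
    also have "ln 4 - ln (2 * radius d i / real d) = ln (4 / (2 * radius d i / real d))"
      using rb d by (intro ln_divide_pos[symmetric]) auto
    also have "4 / (2 * radius d i / real d) = 800 * (real d * real d) * 2 ^ i"
      using d by (simp add: radius_def field_simps)
    also have "ln \<dots> = ln 800 + 2 * ln (real d) + real i * ln 2"
      using d by (simp add: ln_mult ln_realpow)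
    also have "\<dots> \<le> 7 + 2 * ?L + real i"
    proof -
      have "ln (800::real) \<le> ln (2 ^ 10)" by (intro ln_mono) auto
      also have "\<dots> = 10 * ln 2" by (subst ln_realpow) simp
      also have "\<dots> \<le> 7" using ln2_le_25_over_36 by simp
      finally have "ln (800::real) \<le> 7" .
      moreover have "ln (real d) \<le> ?L" using d by simp
      moreover have "real i * ln 2 \<le> real i * 1"
        using ln_le_minus_one[of "2::real"] by (intro mult_left_mono) auto
      ultimately show ?thesis by linarith
    qed
    finally show ?thesis using d by (simp add: algebra_simps)
  qed
  have geo: "(\<Sum>i<n. (1 / 2 :: real) ^ i) \<le> 2" for n
    by (simp add: sum_gp_strict)
  have arith_geo: "(\<Sum>i<n. (1 / 2 :: real) ^ i * real i) \<le> 2" for n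
  proof -
    have "(\<Sum>i<n. (1 / 2 :: real) ^ i * real i) = 2 - (real n + 1) * (1 / 2) ^ n * 2"
      by (induction n) (simp_all add: algebra_simps add_divide_distrib)
    then show ?thesis by simp
  qed
  have "potential d n {} (Collect (in_ball d)) - potential d n X S
      = (\<Sum>i<n. (1 / 2) ^ i * (ln (V i) - ln (W i)))"
    by (simp add: potential_def V_def W_def sum_subtractf algebra_simps)
  also have "\<dots> \<le> (\<Sum>i<n. (1 / 2) ^ i * (real d * (7 + 2 * ?L) + real d * real i))"
    using step by (intro sum_mono mult_left_mono) auto
  also have "\<dots> = real d * (7 + 2 * ?L) * (\<Sum>i<n. (1 / 2) ^ i) + real d * (\<Sum>i<n. (1 / 2) ^ i * real i)"
    by (simp add: sum_distrib_left sum.distrib algebra_simps)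
  also have "\<dots> \<le> real d * (7 + 2 * ?L) * 2 + real d * 2"
    using geo arith_geo by (intro add_mono mult_left_mono) auto
  also have "\<dots> = real d * (16 + 4 * ?L)" by (simp add: algebra_simps)
  also have "\<dots> \<le> real d * (36 * ?L)"
  \<comment> \<open>Since \<open>d \<ge> 1\<close>, \<open>?L\<close> is at least
    \<open>ln 2 \<ge> 1 / 2\<close>, so the constant 16 is absorbed by
    \<open>32 * ?L\<close>.\<close>
  proof (intro mult_left_mono)
    have "1 / 2 \<le> ln (2::real)" using ln_le_minus_one[of "1 / 2 :: real"] by (simp add: ln_div)
    also have "\<dots> \<le> ?L" using d by simp
    finally show "16 + 4 * ?L \<le> 36 * ?L" by simp
  qed simp
  finally show ?thesis by (simp add: mult_ac)
qed

text \<open>The per-round bounds telescope. The constant is \<open>1728 = 24 * 2 * 36\<close>, the 2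
  counting the seller's and the buyer's knowledge sets.\<close>

lemma learner_bounds:
  assumes d: "d \<ge> 1" and s: "in_ball d s" and b: "in_ball d b" and x: "\<And>t. in_ball d (x t)"
  shows "regret learner d s b x T \<le> 1728 * real d * ln (real d + 1)"
    and "neg_profit learner d s b x T \<le> 1728 * real d * ln (real d + 1)"
proof -
  define k where "k t = knowledge_of d (hist learner d s b x t)" for t
  let ?st = "\<lambda>t. inner_d d s (x t)" and ?bt = "\<lambda>t. inner_d d b (x t)"
  let ?pq = "\<lambda>t. post d (k t) (x t)"
  have k_0: "k 0 = ({}, Collect (in_ball d), Collect (in_ball d))"
    by (simp add: k_def knowledge_of_def)
  have k_Suc: "k (Suc t) = learn d (k t) (x t, trade (?st t) (?bt t) (?pq t))" for t
    by (simp add: k_def knowledge_of_def learner_def)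
  have pq: "prices learner d s b x t = ?pq t" for t
    by (simp add: prices_def learner_def k_def)
  have sound: "sound d s b (k t)" for t
  proof (induction t)
    case 0
    then show ?case using s b by (simp add: k_0)
  next
    case (Suc t)
    then show ?case unfolding k_Suc by (rule round_step(1)[OF d _ x])
  qed
  have mono: "resolves d n (k t) (x t)" if "resolves d m (k t) (x t)" "m \<le> n" for m n t
    using that by (cases "k t") auto
  have "\<exists>m. resolves d m (k t) (x t)" for t
  proof -
    obtain X S B where "k t = (X, S, B)" by (cases "k t")
    then show ?thesis
      by (intro exI[of _ "Suc (scale (width d S (x t)) + scale (width d B (x t)))"]) simp
  qed
  then obtain m where m: "resolves d (m t) (k t) (x t)" for t by metis
  \<comment> \<open>Any common upper bound of the finitely many cutoffs works, as the final bound
    does not depend on \<open>n\<close>.\<close>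
  define n where "n = (\<Sum>t<T. m t)"
  have n: "resolves d n (k t) (x t)" if "t < T" for t
    by (rule mono[OF m]) (use that in \<open>auto simp: n_def intro!: member_le_sum\<close>)
  let ?\<Phi> = "\<lambda>t. total_potential d n (k t)"
  have tele: "(\<Sum>t<T. 24 * (?\<Phi> t - ?\<Phi> (Suc t))) \<le> 1728 * real d * ln (real d + 1)"
  proof -
    obtain X S B where kT: "k T = (X, S, B)" by (cases "k T")
    with sound[of T] have "?\<Phi> 0 - ?\<Phi> T \<le> 72 * real d * ln (real d + 1)"
      using potential_drop_le[of S d s X n] potential_drop_le[of B d b X n] d by (simp add: k_0 kT)
    then show ?thesis
      unfolding sum_distrib_left[symmetric] sum_lessThan_telescope'[of ?\<Phi> T] by simp
  qed
  have "regret learner d s b x T = (\<Sum>t<T. round_regret (?st t) (?bt t) (?pq t))"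
    by (simp add: regret_def round_regret_def sum_subtractf pq)
  also have "\<dots> \<le> (\<Sum>t<T. 24 * (?\<Phi> t - ?\<Phi> (Suc t)))"
    unfolding k_Suc by (intro sum_mono round_step(2)[OF d sound x] n) simp
  finally show "regret learner d s b x T \<le> 1728 * real d * ln (real d + 1)" using tele by linarith
  have "neg_profit learner d s b x T = (\<Sum>t<T. round_deficit (?st t) (?bt t) (?pq t))"
    by (simp add: neg_profit_def round_deficit_def pq)
  also have "\<dots> \<le> (\<Sum>t<T. 24 * (?\<Phi> t - ?\<Phi> (Suc t)))"
    unfolding k_Suc by (intro sum_mono round_step(3)[OF d sound x] n) simp
  finally show "neg_profit learner d s b x T \<le> 1728 * real d * ln (real d + 1)" using tele by linarith
qed

text \<open>The learner is deterministic, so no expectation appears, and it does not depend on the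
  horizon. \<open>ln (d + 1)\<close> replaces \<open>log d\<close>, which vanishes at
  \<open>d = 1\<close>.\<close>

theorem theorem4p4:
  shows "\<exists>(A::policy) (C::real). \<forall>d::nat. \<forall>s b x T.
           d \<ge> 1 \<longrightarrow> in_ball d s \<longrightarrow> in_ball d b \<longrightarrow> (\<forall>t. in_ball d (x t)) \<longrightarrow>
           regret A d s b x T \<le> C * real d * ln (real d + 1) \<and>
           neg_profit A d s b x T \<le> C * real d * ln (real d + 1)"
  using learner_bounds by blast

end
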